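(* Let $N\ge2$ and $s\in(0,1)$. Let $\mathcal I=\mathcal I_k^-$ for some $1\le k\le N$, or $\mathcal I=\mathcal I_N^+$. Then for any $p<-1$ there exists a supersolution $u\in C^{0,\frac{2s}{1-p}}(\mathbb{R}^N)\cap C^\infty(\mathbb{R}^N_+)$, positive in $\mathbb{R}^N_+$, of $$\mathcal Iu(x)+u^p(x)=0\quad\text{in }\mathbb{R}^N_+$$ such that $u(x)=0$ for any $x\in\mathbb{R}^N\setminus\mathbb{R}^N_+$.
   Context: $\mathbb{R}^N_+=\{x=(x',x_N)\in\mathbb{R}^{N-1}\times\mathbb{R}: x_N>0\}$. $C^{0,\alpha}(\mathbb{R}^N)$ is the space of $\alpha$-Hölder continuous functions on $\mathbb{R}^N$ (not necessarily bounded). For a unit vector $\xi\in\mathbb{R}^N$, $$\mathcal I_\xi u(x)=C_s\int_0^{+\infty}\frac{u(x+\tau\xi)+u(x-\tau\xi)-2u(x)}{\tau^{1+2s}}\,d\tau,$$ where $C_s>0$ is a normalizing constant depending only on $s$ (chosen so that $\mathcal I_\xi u(x)\to\langle D^2u(x)\xi,\xi\rangle$ as $s\to1^-$). $\mathcal V_k$ is the set of $k$-element orthonormal families $\{\xi_1,\dots,\xi_k\}$ in $\mathbb{R}^N$, and $$\mathcal I_k^-u(x)=\inf_{\{\xi_i\}\in\mathcal V_k}\sum_{i=1}^k\mathcal I_{\xi_i}u(x),\qquad \mathcal I_k^+u(x)=\sup_{\{\xi_i\}\in\mathcal V_k}\sum_{i=1}^k\mathcal I_{\xi_i}u(x).$$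 $\mathcal S$ is the space of functions $u:\mathbb{R}^N\to\mathbb{R}$ such that (i) for every $x\in\mathbb{R}^N_+$ and unit vector $\xi$, the map $\tau\in\mathbb{R}\mapsto u(x+\tau\xi)$ is measurable; (ii) there are $\alpha\in[0,2s)$ and $C>0$ with $|u(x)|\le C(1+|x|)^\alpha$ for all $x\in\mathbb{R}^N$. For $u\in\mathcal S$ which is $C^2$ in $\mathbb{R}^N_+$, $\mathcal Iu(x)$ is well defined at every $x\in\mathbb{R}^N_+$, and $u>0$ in $\mathbb{R}^N_+$ is a supersolution of $\mathcal Iu+u^p=0$ in $\mathbb{R}^N_+$ if $\mathcal Iu(x)+u(x)^p\le0$ for all $x\in\mathbb{R}^N_+$ (for such $u$ this coincides with the notion of viscosity supersolution, where $C^2$ functions touching $u$ from below at a point of $\mathbb{R}^N_+$ on a small ball, extended by $u$ outside the ball, are used as test functions). *)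

theory Defs
  imports "HOL-Analysis.Analysis"
begin

(* The last coordinate x_N is the coordinate with index l; the index type carries no order,
   so l is a parameter. *)
definition half_space :: "'n::finite \<Rightarrow> (real ^ 'n) set" where
  "half_space l = {x. x $ l > 0}"

(* C^k on an open set S, through iterated directional derivatives of the Frechet derivative. *)
primrec Ck_on :: "nat \<Rightarrow> 'a::euclidean_space set \<Rightarrow> ('a \<Rightarrow> real) \<Rightarrow> bool" where
  "Ck_on 0 S f \<longleftrightarrow> continuous_on S f"
| "Ck_on (Suc k) S f \<longleftrightarrow>
     (\<forall>x\<in>S. f differentiable (at x)) \<and>
     (\<forall>v. Ck_on k S (\<lambda>x. frechet_derivative f (at x) v))"

definition Cinf_on :: "'a::euclidean_space set \<Rightarrow> ('a \<Rightarrow> real) \<Rightarrow> bool" where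
  "Cinf_on S f \<longleftrightarrow> (\<forall>k. Ck_on k S f)"

(* Globally Hoelder continuous on the whole space, not necessarily bounded. *)
definition holder_space :: "real \<Rightarrow> ('a::real_normed_vector \<Rightarrow> real) set" where
  "holder_space \<gamma> = {u. \<exists>L\<ge>0. \<forall>x y. \<bar>u x - u y\<bar> \<le> L * norm (x - y) powr \<gamma>}"

(* c > 0 is the value C_s of the normalizing constant.  Its normalization as s tends to 1 is
   asymptotic and does not restrict the value at one fixed s, so c is left as a parameter. *)
definition I_dir :: "real \<Rightarrow> real \<Rightarrow> 'a::euclidean_space \<Rightarrow> ('a \<Rightarrow> real) \<Rightarrow> 'a \<Rightarrow> real" where
  "I_dir c s \<xi> u x =
     c * (LINT \<tau>:{0<..}|lebesgue.
            (u (x + \<tau> *\<^sub>R \<xi>) + u (x - \<tau> *\<^sub>R \<xi>) - 2 * u x) / \<tau> powr (1 + 2 * s))"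

definition orthonormal_families :: "nat \<Rightarrow> 'a::euclidean_space set set" where
  "orthonormal_families k =
     {B. finite B \<and> card B = k \<and> (\<forall>\<xi>\<in>B. norm \<xi> = 1) \<and> pairwise orthogonal B}"

(* Lebesgue integral, infimum and supremum are total in HOL.  For u in growth_space that is C^2 in
   the half-space, x in the half-space and 1 <= k <= N, the integrals converge absolutely and
   are bounded uniformly in the direction, so below these are the genuine values. *)
definition I_minus :: "real \<Rightarrow> real \<Rightarrow> nat \<Rightarrow> ('a::euclidean_space \<Rightarrow> real) \<Rightarrow> 'a \<Rightarrow> real" where
  "I_minus c s k u x = (INF B\<in>orthonormal_families k. \<Sum>\<xi>\<in>B. I_dir c s \<xi> u x)"

definition I_plus :: "real \<Rightarrow> real \<Rightarrow> nat \<Rightarrow> ('a::euclidean_space \<Rightarrow> real) \<Rightarrow> 'a \<Rightarrow> real" where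
  "I_plus c s k u x = (SUP B\<in>orthonormal_families k. \<Sum>\<xi>\<in>B. I_dir c s \<xi> u x)"

(* The space called S in the literature. *)
definition growth_space :: "real \<Rightarrow> 'n::finite \<Rightarrow> (real ^ 'n \<Rightarrow> real) set" where
  "growth_space s l =
     {u. (\<forall>x\<in>half_space l. \<forall>\<xi>. norm \<xi> = 1 \<longrightarrow> (\<lambda>\<tau>. u (x + \<tau> *\<^sub>R \<xi>)) \<in> borel_measurable lebesgue) \<and>
         (\<exists>\<alpha> C. 0 \<le> \<alpha> \<and> \<alpha> < 2 * s \<and> C > 0 \<and> (\<forall>x. \<bar>u x\<bar> \<le> C * (1 + norm x) powr \<alpha>))}"

(* Pointwise (classical) supersolutions of I u + u^p = 0 in the half-space. *)
definition supersolution ::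
  "real \<Rightarrow> 'n::finite \<Rightarrow> ((real ^ 'n \<Rightarrow> real) \<Rightarrow> real ^ 'n \<Rightarrow> real) \<Rightarrow> real \<Rightarrow> (real ^ 'n \<Rightarrow> real) \<Rightarrow> bool"
  where
  "supersolution s l I p u \<longleftrightarrow>
     u \<in> growth_space s l \<and> Ck_on 2 (half_space l) u \<and>
     (\<forall>x\<in>half_space l. u x > 0) \<and>
     (\<forall>x\<in>half_space l. I u x + u x powr p \<le> 0)"

end

theory Submission
  imports Defs "HOL-Real_Asymp.Real_Asymp"
begin

text \<open>
  The solution is \<open>u x = A * max 0 (x $ l) powr g\<close> with \<open>g = 2 * s / (1 - p) < s\<close>. By homogeneity
  \<open>I_dir c s \<xi> u x = c * A * \<bar>\<xi> $ l\<bar> powr (2 * s) * (x $ l) powr (g - 2 * s) * \<Phi> g\<close>, where \<open>\<Phi> g\<close> is the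
  integral of the kernel below, and \<open>g - 2 * s = g * p\<close>, so that only \<open>\<Phi> g < 0\<close> is needed, with \<open>A\<close>
  chosen large. An explicit primitive gives \<open>\<Phi> s = 0\<close> (the function \<open>max 0 t powr s\<close> is s-harmonic on
  the half-line), and Young's inequality, i.e. convexity of \<open>g \<mapsto> \<Phi> g\<close>, compares \<open>\<Phi> g\<close> strictly with
  \<open>\<Phi> s\<close>. For the supremum over full orthonormal bases, \<open>\<Sum>\<bar>\<xi> $ l\<bar> powr (2 * s) \<ge> \<Sum>(\<xi> $ l)\<^sup>2 = 1\<close>.
\<close>

section \<open>The one-dimensional kernel and its integrability\<close>

text \<open>The weighted second difference of \<open>max 0 t powr g\<close> at \<open>t = 1\<close>;
  the step \<open>r\<close> is measured in multiples of the distance to the boundary. Since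
  \<open>0 powr g = 0\<close>, the truncation by \<open>max 0\<close> is the zero extension once
  \<open>r\<close> reaches 1.\<close>

definition profile_kernel :: "real \<Rightarrow> real \<Rightarrow> real \<Rightarrow> real" where
  "profile_kernel s g r = ((1 + r) powr g + max 0 (1 - r) powr g - 2) / r powr (1 + 2 * s)"

text \<open>A concave power lies below its tangent at 1. This serves both the upper bound on the
  numerator and the comparison with the critical exponent.\<close>

lemma powr_le_affine:
  fixes a t :: real
  assumes "0 \<le> a" "0 < t" "t \<le> 1"
  shows "a powr t \<le> 1 - t + t * a"
proof (cases "a = 0")
  case False
  then show ?thesis
    using Youngs_inequality_0[of t "1 - t" a 1] assms by simp
qed (use assms in auto)

text \<open>The linear terms of the two tangent bounds cancel, so the numerator is at most 0. A
  Taylor bound from below would degenerate as \<open>r\<close> tends to 1; the AM-GM inequality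
  instead gives the lower bound 2 (1 - r^2)^(g/2) - 2, which is at least -2 r^2 on the whole
  interval.\<close>

lemma kernel_numerator_bounds:
  fixes g r :: real
  assumes "0 < g" "g \<le> 1" "0 < r" "r \<le> 1"
  shows "\<bar>(1 + r) powr g + max 0 (1 - r) powr g - 2\<bar> \<le> 2 * r\<^sup>2"
proof -
  have "(1 + r) powr g \<le> 1 + g * r" "max 0 (1 - r) powr g \<le> 1 - g * r"
    using powr_le_affine[of "1 + r" g] powr_le_affine[of "1 - r" g] assms
    by (auto simp: algebra_simps)
  then have upper: "(1 + r) powr g + max 0 (1 - r) powr g \<le> 2" by linarith
  have "1 - r\<^sup>2 \<le> ((1 + r) powr (g/2)) * (max 0 (1 - r) powr (g/2))"
  proof -
    have sq: "1 - r\<^sup>2 = (1 + r) * max 0 (1 - r)"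
      using assms by (auto simp: max_def power2_eq_square algebra_simps)
    have range: "0 \<le> 1 - r\<^sup>2" "1 - r\<^sup>2 \<le> 1"
      using assms by (auto simp: power_le_one)
    have "(1 - r\<^sup>2) powr 1 \<le> (1 - r\<^sup>2) powr (g/2)"
      using assms range by (intro powr_mono') auto
    then show ?thesis
      using range assms by (simp add: sq powr_mult)
  qed
  also have "2 * \<dots> \<le> (1 + r) powr g + max 0 (1 - r) powr g"
  proof -
    have "((1 + r) powr (g/2))\<^sup>2 = (1 + r) powr g" "(max 0 (1 - r) powr (g/2))\<^sup>2 = max 0 (1 - r) powr g"
      by (simp_all add: power2_eq_square flip: powr_add)
    then show ?thesis
      using sum_squares_bound[of "(1 + r) powr (g/2)" "max 0 (1 - r) powr (g/2)"] by simp
  qed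
  finally show ?thesis using upper by simp
qed

lemma profile_kernel_measurable [measurable]: "profile_kernel s g \<in> borel_measurable borel"
  unfolding profile_kernel_def by measurable

text \<open>Near 0 the quadratic cancellation leaves the exponent 1 - 2s > -1; at infinity the
  growth of order \<open>g\<close> leaves g - 1 - 2s < -1.\<close>

lemma profile_kernel_integrable:
  assumes "0 < s" "s < 1" "0 < g" "g \<le> 1" "g < 2 * s"
  shows "set_integrable lborel {0<..} (profile_kernel s g)"
proof -
  have m: "profile_kernel s g \<in> borel_measurable (lebesgue_on A)" for A
    by (intro measurable_restrict_space1 measurable_completion) simp
  have "profile_kernel s g absolutely_integrable_on {0<..1}"
  proof (rule measurable_bounded_by_integrable_imp_absolutely_integrable[OF m])
    show "(\<lambda>r. 2 * r powr (1 - 2 * s)) integrable_on {0<..1}"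
      using assms by (intro integrable_on_mult_right integrable_on_powr_from_0') auto
    fix r :: real assume "r \<in> {0<..1}"
    then have r: "0 < r" "r \<le> 1" by auto
    have "2 * r\<^sup>2 / r powr (1 + 2 * s) = 2 * r powr (1 - 2 * s)"
      using r by (simp add: powr_diff powr_add field_simps powr_numeral power2_eq_square)
    then show "norm (profile_kernel s g r) \<le> 2 * r powr (1 - 2 * s)"
      using divide_right_mono[OF kernel_numerator_bounds[OF assms(3,4) r], of "r powr (1 + 2 * s)"]
      by (simp add: profile_kernel_def)
  qed simp
  moreover have "profile_kernel s g absolutely_integrable_on {1..}"
  proof (rule measurable_bounded_by_integrable_imp_absolutely_integrable[OF m])
    show "(\<lambda>r. 4 * r powr (g - 1 - 2 * s)) integrable_on {1..}"
      using has_integral_powr_to_inf[of "g - 1 - 2 * s" 1] assms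
      by (intro integrable_on_mult_right) (auto simp: integrable_on_def)
    fix r :: real assume "r \<in> {1..}"
    then have r: "1 \<le> r" by auto
    have "(1 + r) powr g \<le> (2 * r) powr g"
      using r assms by (intro powr_mono2) auto
    also have "\<dots> = 2 powr g * r powr g" using r by (simp add: powr_mult)
    also have "\<dots> \<le> 2 powr 1 * r powr g"
      using assms by (intro mult_right_mono powr_mono) auto
    finally have "(1 + r) powr g \<le> 2 * r powr g" by simp
    moreover have "1 \<le> r powr g" using r assms by (simp add: ge_one_powr_ge_zero)
    moreover have "0 \<le> (1 + r) powr g" by simp
    moreover have "max 0 (1 - r) powr g = 0" using r by simp
    ultimately have "\<bar>(1 + r) powr g + max 0 (1 - r) powr g - 2\<bar> \<le> 4 * r powr g"
      using r by linarith
    moreover have "4 * r powr g / r powr (1 + 2 * s) = 4 * r powr (g - 1 - 2 * s)"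
      using r by (simp add: powr_diff powr_add field_simps)
    ultimately show "norm (profile_kernel s g r) \<le> 4 * r powr (g - 1 - 2 * s)"
      using divide_right_mono[of _ "4 * r powr g" "r powr (1 + 2 * s)"]
      by (fastforce simp: profile_kernel_def)
  qed simp
  ultimately have "profile_kernel s g absolutely_integrable_on ({0<..1} \<union> {1..})"
    by (rule set_integrable_Un) auto
  moreover have "{0<..1} \<union> {1..} = {0::real<..}" by auto
  ultimately have "set_integrable lebesgue {0<..} (profile_kernel s g)" by simp
  then show ?thesis
    \<comment> \<open>The kernel is Borel measurable, so integrability descends from the completed
      measure to \<open>lborel\<close>.\<close>
    unfolding set_integrable_def by (subst (asm) integrable_completion) auto
qed

section \<open>The critical exponent: the integral vanishes\<close>

text \<open>The negative of the backward half of \<open>profile_kernel s s\<close>. It behaves like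
  s t^(-2s) at 0, so for s \<ge> 1/2 it is not integrable there, and the two halves of the kernel
  cannot be integrated separately.\<close>

definition tail_kernel :: "real \<Rightarrow> real \<Rightarrow> real" where
  "tail_kernel s t = (1 - max 0 (1 - t) powr s) / t powr (1 + 2 * s)"

lemma isCont_tail_kernel: "0 < s \<Longrightarrow> 0 < t \<Longrightarrow> isCont (tail_kernel s) t"
  unfolding tail_kernel_def isCont_def by (auto intro!: tendsto_intros tendsto_powr')

lemma tail_kernel_bounds:
  assumes "0 < s" "s \<le> 1" "0 < t" "t \<le> 1"
  shows "0 \<le> tail_kernel s t" "tail_kernel s t \<le> t powr (- 2 * s)"
proof -
  have "max 0 (1 - t) powr s \<le> 1"
    using assms by (auto simp: max_def intro!: powr_le1)
  then show "0 \<le> tail_kernel s t" by (simp add: tail_kernel_def)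
  have "1 - t \<le> max 0 (1 - t) powr s"
    using assms powr_mono'[of s 1 "1 - t"] by auto
  then have "tail_kernel s t \<le> t / t powr (1 + 2 * s)"
    unfolding tail_kernel_def by (intro divide_right_mono) auto
  also have "\<dots> = t powr (- 2 * s)"
    using assms by (simp add: powr_add powr_minus field_simps)
  finally show "tail_kernel s t \<le> t powr (- 2 * s)" .
qed

text \<open>
  The substitution \<open>t = r / (1 + r)\<close> turns \<open>((1 + r) powr s - 1) / r powr (1 + 2 * s)\<close> into
  \<open>tail_kernel s t\<close> up to the derivative of the second summand below. Hence the primitive \<open>q\<close>, which
  is not explicit, enters only through a difference of two of its values.
\<close>
lemma profile_kernel_primitive:
  assumes "0 < s" "0 < r"
    and q: "\<And>t. 0 < t \<Longrightarrow> (q has_real_derivative tail_kernel s t) (at t)"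
  shows "((\<lambda>r. q (r / (1 + r)) + ((1 + r) powr s - 1)\<^sup>2 * r powr (- 2 * s) / (2 * s) - q r)
           has_real_derivative profile_kernel s s r) (at r)"
proof -
  define x where "x = r / (1 + r)"
  define D where "D = (1 + r) powr s"
  define E where "E = r powr (-1 - 2 * s)"
  have x: "0 < x" using assms by (simp add: x_def)
  have "((\<lambda>r. r / (1 + r)) has_real_derivative 1 / (1 + r)\<^sup>2) (at r)"
    using assms by (auto intro!: derivative_eq_intros simp: power2_eq_square field_simps)
  from DERIV_chain2[OF q this] x
  have 1: "((\<lambda>r. q (r / (1 + r))) has_real_derivative tail_kernel s x * (1 / (1 + r)\<^sup>2)) (at r)"
    by (simp add: x_def)
  have 2: "((\<lambda>r. ((1 + r) powr s - 1)\<^sup>2 * r powr (- 2 * s) / (2 * s)) has_real_derivative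
      (2 * (D - 1) * (s * (1 + r) powr (s - 1)) * r powr (- 2 * s)
        + (D - 1)\<^sup>2 * (- 2 * s * r powr (- 2 * s - 1))) / (2 * s)) (at r)"
    using assms by (auto intro!: derivative_eq_intros simp: D_def)
      (simp add: field_simps power2_eq_square)
  have e1: "(1 + r) powr (s - 1) = D / (1 + r)" using assms by (simp add: D_def powr_diff)
  have e2: "r powr (- 2 * s) = r * E"
    using assms by (simp add: E_def powr_diff powr_minus_divide)
  have e3: "r powr (- 2 * s - 1) = E"
    unfolding E_def by (rule arg_cong[of _ _ "(powr) r"]) simp
  have "tail_kernel s x = (D - 1) * (1 + r) * D * E"
  proof -
    have w: "max 0 (1 - x) = 1 / (1 + r)" using assms by (simp add: x_def field_simps max_def)
    have "x powr (1 + 2 * s) = r powr (1 + 2 * s) / (1 + r) powr (1 + 2 * s)"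
      using assms by (simp add: x_def powr_divide)
    also have "(1 + r) powr (1 + 2 * s) = (1 + r) * D\<^sup>2"
      using assms powr_add[of "1 + r" s s] by (simp add: D_def powr_add power2_eq_square)
    also have "r powr (1 + 2 * s) = 1 / E"
      using powr_minus_divide[of r "1 + 2 * s"] by (simp add: E_def algebra_simps)
    finally have "x powr (1 + 2 * s) = 1 / (E * ((1 + r) * D\<^sup>2))" by simp
    moreover have "(1 / (1 + r)) powr s = 1 / D" using assms by (simp add: D_def powr_divide)
    moreover have "D > 0" using assms by (simp add: D_def)
    ultimately show ?thesis unfolding tail_kernel_def w
      by (simp only:) (simp add: field_simps power2_eq_square)
  qed
  moreover have "profile_kernel s s r = (D - 1) * E - tail_kernel s r"
  proof -
    have "y / r powr (1 + 2 * s) = y * E" for y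
      using powr_minus_divide[of r "1 + 2 * s"] by (simp add: E_def algebra_simps)
    then show ?thesis
      unfolding profile_kernel_def tail_kernel_def D_def[symmetric] by (simp add: algebra_simps)
  qed
  \<comment> \<open>After (D - 1) E is factored out, there remains D/(1+r) + D r/(1+r) - (D - 1) =
    1. The squared term in the primitive is chosen for this cancellation.\<close>
  moreover have "(D - 1) * (1 + r) * D * E * (1 / (1 + r)\<^sup>2) +
      (2 * (D - 1) * (s * (D / (1 + r))) * (r * E) + (D - 1)\<^sup>2 * (- 2 * s * E)) / (2 * s) = (D - 1) * E"
    using assms by (simp add: divide_simps power2_eq_square) (simp add: algebra_simps)
  ultimately show ?thesis
    using DERIV_diff[OF DERIV_add[OF 1 2] q[OF assms(2)]] by (simp only: e1 e2 e3)
qed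

text \<open>The primitive \<open>W\<close> tends to 0 at both ends. At 0, the points r/(1+r) and r
  differ by at most r^2, which outweighs the singularity r^(-2s). At infinity, \<open>q r\<close>
  tends to q 1 + 1/(2s), and the limit 1/(2s) of \<open>K\<close> makes up exactly for the second
  summand.\<close>

lemma profile_kernel_integral_critical:
  assumes "0 < s" "s < 1"
  shows "(LINT r:{0<..}|lborel. profile_kernel s s r) = 0"
proof -
  obtain q where "\<forall>t::real. 0 < ereal t \<longrightarrow> ereal t < \<infinity> \<longrightarrow> (q has_vector_derivative tail_kernel s t) (at t)"
    using einterval_antiderivative[of 0 \<infinity> "tail_kernel s"] isCont_tail_kernel[OF assms(1)] by auto
  then have q: "(q has_real_derivative tail_kernel s t) (at t)" if "0 < t" for t
    using that by (auto simp: has_real_derivative_iff_has_vector_derivative)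
  define K where "K r = ((1 + r) powr s - 1)\<^sup>2 * r powr (- 2 * s) / (2 * s)" for r
  define W where "W r = q (r / (1 + r)) + K r - q r" for r
  have deriv: "(W has_real_derivative profile_kernel s s r) (at r)" if "0 < r" for r
    using profile_kernel_primitive[OF assms(1) that q] by (simp add: W_def[abs_def] K_def)
  \<comment> \<open>The 4 bounds 2^(2s), which appears because the mean value point is at least r/2;
    the 1/(2s) comes from \<open>K\<close>.\<close>
  have near_0: "norm (W r) \<le> (4 + 1 / (2 * s)) * r powr (2 - 2 * s)" if r: "0 < r" "r < 1" for r
  proof -
    define x where "x = r / (1 + r)"
    have x: "0 < x" "x < r" "r / 2 \<le> x" "r - x \<le> r\<^sup>2"
      using r by (auto simp: x_def field_simps power2_eq_square)
    obtain z where z: "x < z" "z < r" "q r - q x = (r - x) * tail_kernel s z"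
      using MVT2[OF x(2), of q "tail_kernel s"] q x by force
    have "z powr (- 2 * s) \<le> (r / 2) powr (- 2 * s)"
      using x z r assms by (intro powr_mono2') auto
    also have "\<dots> = 2 powr (2 * s) * r powr (- 2 * s)"
      using r by (simp add: powr_divide powr_minus field_simps)
    also have "\<dots> \<le> 2 powr 2 * r powr (- 2 * s)"
      using assms by (intro mult_right_mono powr_mono) auto
    finally have "tail_kernel s z \<le> 4 * r powr (- 2 * s)"
      using tail_kernel_bounds(2)[of s z] x z r assms by (simp add: powr_numeral)
    moreover have "0 \<le> tail_kernel s z" using tail_kernel_bounds(1)[of s z] x z r assms by simp
    ultimately have "\<bar>q r - q x\<bar> \<le> r\<^sup>2 * (4 * r powr (- 2 * s))"
      unfolding z(3) using x by (auto simp: abs_mult intro!: mult_mono)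
    moreover have "\<bar>K r\<bar> \<le> r\<^sup>2 * r powr (- 2 * s) / (2 * s)"
    proof -
      have "1 \<le> (1 + r) powr s" using r assms by (simp add: ge_one_powr_ge_zero)
      moreover have "(1 + r) powr s \<le> 1 + r" using powr_mono[of s 1 "1 + r"] r assms by simp
      ultimately have "((1 + r) powr s - 1)\<^sup>2 \<le> r\<^sup>2" by (intro power_mono) auto
      then show ?thesis using assms
        by (auto simp: K_def abs_mult intro!: divide_right_mono mult_right_mono)
    qed
    moreover have "r\<^sup>2 * r powr (- 2 * s) = r powr (2 - 2 * s)"
      using r by (simp add: powr_diff powr_minus powr_numeral field_simps)
    ultimately show ?thesis by (simp add: W_def x_def algebra_simps)
  qed
  have "(W \<longlongrightarrow> 0) (at_right 0)"
  proof (rule Lim_null_comparison)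
    show "\<forall>\<^sub>F r in at_right 0. norm (W r) \<le> (4 + 1 / (2 * s)) * r powr (2 - 2 * s)"
      using near_0 by (auto simp: eventually_at_right_field intro!: exI[of _ 1])
    have "((\<lambda>r. r powr (2 - 2 * s)) \<longlongrightarrow> 0 powr (2 - 2 * s)) (at_right 0)"
      using assms by (intro tendsto_powr' tendsto_intros) (auto simp: eventually_at_right_field intro!: exI[of _ 1])
    then show "((\<lambda>r. (4 + 1 / (2 * s)) * r powr (2 - 2 * s)) \<longlongrightarrow> 0) (at_right 0)"
      by (intro tendsto_mult_right_zero) simp
  qed
  moreover have "(W \<longlongrightarrow> 0) at_top"
  proof -
    \<comment> \<open>Beyond 1 the truncated power is 0, so \<open>tail_kernel\<close> is a pure
      power and \<open>q\<close> is explicit up to its value at 1.\<close>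
    have q_tail: "q r = q 1 + (1 - r powr (- 2 * s)) / (2 * s)" if "1 < r" for r
    proof -
      have d: "((\<lambda>t. q t + t powr (- 2 * s) / (2 * s)) has_real_derivative 0) (at t)" if "1 \<le> t" for t
      proof -
        have "- (1 + 2 * s) = - 2 * s - 1" by simp
        then have "tail_kernel s t = t powr (- 2 * s - 1)"
          using that powr_minus_divide[of t "1 + 2 * s"]
          by (simp only:) (simp add: tail_kernel_def)
        then show ?thesis
          using that assms by (auto intro!: derivative_eq_intros q)
      qed
      have "q r + r powr (- 2 * s) / (2 * s) = q 1 + 1 powr (- 2 * s) / (2 * s)"
        using that d by (intro DERIV_isconst_end DERIV_continuous_on) (auto intro: has_field_derivative_at_within)
      then show ?thesis by (simp add: diff_divide_distrib)
    qed
    have "((\<lambda>r::real. r / (1 + r)) \<longlongrightarrow> 1) at_top" by real_asymp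
    moreover have "isCont q 1" using q[of 1] DERIV_isCont by force
    ultimately have "((\<lambda>r. q (r / (1 + r))) \<longlongrightarrow> q 1) at_top"
      by (rule isCont_tendsto_compose[rotated])
    moreover have "((\<lambda>r. ((1 + r) powr s - 1)\<^sup>2 * r powr (- 2 * s) / (2 * s)) \<longlongrightarrow> 1 / (2 * s)) at_top"
      using assms by real_asymp (simp add: field_simps)
    moreover have "((\<lambda>r. q 1 + (1 - r powr (- 2 * s)) / (2 * s)) \<longlongrightarrow> q 1 + 1 / (2 * s)) at_top"
      using assms by real_asymp (simp add: field_simps)
    ultimately have "((\<lambda>r. q (r / (1 + r)) + K r - (q 1 + (1 - r powr (- 2 * s)) / (2 * s)))
        \<longlongrightarrow> q 1 + 1 / (2 * s) - (q 1 + 1 / (2 * s))) at_top"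
      unfolding K_def by (rule tendsto_diff[OF tendsto_add])
    moreover have "\<forall>\<^sub>F r in at_top. q (r / (1 + r)) + K r - (q 1 + (1 - r powr (- 2 * s)) / (2 * s)) = W r"
      using eventually_gt_at_top[of 1] by eventually_elim (simp add: W_def q_tail)
    ultimately show ?thesis using Lim_transform_eventually by force
  qed
  moreover have "einterval 0 \<infinity> = {0<..}" by (auto simp: einterval_def)
  moreover have "isCont (profile_kernel s s) r" if "0 < r" for r
    using that assms unfolding profile_kernel_def isCont_def
    by (auto intro!: tendsto_intros tendsto_powr')
  ultimately have "(LBINT r=0..\<infinity>. profile_kernel s s r) = 0 - 0"
    using profile_kernel_integrable[of s s] deriv assms
    by (intro interval_integral_FTC_integrable[where F = W])
      (auto simp: has_real_derivative_iff_has_vector_derivative ereal_tendsto_simps zero_ereal_def)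
  then show ?thesis
    by (simp add: interval_lebesgue_integral_def \<open>einterval 0 \<infinity> = {0<..}\<close>)
qed

section \<open>Subcritical exponents: the integral is negative\<close>

text \<open>Applying the tangent bound to both powers costs 2 (1 - g/s), exactly what the constant
  -2 pays for. For r \<ge> 1 the second power is 0 and needs no bound, so 1 - g/s is left over. This
  gain is kept only on [1, 2], where the weight is at least 2^(-(1+2s)).\<close>

lemma profile_kernel_le_critical:
  assumes "0 < g" "g < s" "0 < r"
  shows "profile_kernel s g r
    \<le> g / s * profile_kernel s s r - (1 - g / s) * 2 powr (- (1 + 2 * s)) * indicator {1..2} r"
proof -
  define \<theta> where "\<theta> = g / s"
  have \<theta>: "0 < \<theta>" "\<theta> < 1" "g = s * \<theta>" using assms by (auto simp: \<theta>_def field_simps)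
  have young: "a powr g \<le> 1 - \<theta> + \<theta> * a powr s" if "0 \<le> a" for a
    using powr_le_affine[of "a powr s" \<theta>] that \<theta> by (simp add: powr_powr)
  define N where "N t = (1 + r) powr t + max 0 (1 - r) powr t - 2" for t
  have "N g \<le> \<theta> * N s - (1 - \<theta>) * indicator {1..2} r"
  proof (cases "r \<ge> 1")
    case True
    then have "max 0 (1 - r) = 0" by simp
    moreover have "indicator {1..2} r \<le> (1::real)" by (simp add: indicator_def)
    ultimately show ?thesis
      using young[of "1 + r"] assms \<theta> mult_left_mono[of "indicator {1..2} r" "1" "1 - \<theta>"]
      by (simp add: N_def algebra_simps)
  next
    case False
    then show ?thesis
      using young[of "1 + r"] young[of "max 0 (1 - r)"] assms by (simp add: N_def algebra_simps)
  qed
  from divide_right_mono[OF this, of "r powr (1 + 2 * s)"]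
  have "profile_kernel s g r
      \<le> \<theta> * profile_kernel s s r - (1 - \<theta>) * indicator {1..2} r / r powr (1 + 2 * s)"
    by (simp add: profile_kernel_def N_def diff_divide_distrib[of "\<theta> * _"])
  also have "(1 - \<theta>) * indicator {1..2} r * 2 powr (- (1 + 2 * s))
      \<le> (1 - \<theta>) * indicator {1..2} r * r powr (- (1 + 2 * s))"
    using assms \<theta> by (cases "r \<in> {1..2}") (auto intro!: mult_left_mono powr_mono2')
  then have "\<theta> * profile_kernel s s r - (1 - \<theta>) * indicator {1..2} r / r powr (1 + 2 * s)
      \<le> \<theta> * profile_kernel s s r - (1 - \<theta>) * 2 powr (- (1 + 2 * s)) * indicator {1..2} r"
    unfolding powr_minus_divide[of r] by (simp add: mult_ac)
  finally show ?thesis by (simp add: \<theta>_def)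
qed

lemma profile_kernel_integral_neg:
  assumes "0 < g" "g < s" "s < 1"
  shows "(LINT r:{0<..}|lborel. profile_kernel s g r) < 0"
proof -
  define d where "d = (1 - g / s) * 2 powr (- (1 + 2 * s))"
  have "d > 0" using assms by (simp add: d_def)
  have inter_eq: "{0<..} \<inter> {1..2::real} = {1..2}" by auto
  have int_s: "set_integrable lborel {0<..} (\<lambda>r. g / s * profile_kernel s s r)"
    using assms by (intro set_integrable_mult_right profile_kernel_integrable) auto
  have int_i: "set_integrable lborel {0<..} (\<lambda>r. d * indicator {1..2::real} r)"
    by (intro set_integrable_mult_right)
      (auto simp: set_integrable_def inter_eq simp flip: indicator_inter_arith intro!: integrable_real_indicator)
  have "(LINT r:{0<..}|lborel. profile_kernel s g r)
      \<le> (LINT r:{0<..}|lborel. g / s * profile_kernel s s r - d * indicator {1..2} r)"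
    using assms profile_kernel_le_critical[of g s] unfolding d_def
    by (intro set_integral_mono profile_kernel_integrable set_integral_diff(1)[OF int_s int_i[unfolded d_def]]) auto
  also have "\<dots> = - (LINT r:{0<..}|lborel. d * indicator {1..2::real} r)"
    using assms unfolding set_integral_diff(2)[OF int_s int_i]
    by (simp add: profile_kernel_integral_critical)
  also have "(LINT r:{0<..}|lborel. d * indicator {1..2::real} r) = d"
    by (simp add: set_lebesgue_integral_def inter_eq flip: indicator_inter_arith)
  finally show ?thesis using \<open>d > 0\<close> by simp
qed

section \<open>Scaling of the directional operator on powers of the last coordinate\<close>

definition half_power :: "real \<Rightarrow> real \<Rightarrow> 'n::finite \<Rightarrow> real ^ 'n \<Rightarrow> real" where
  "half_power A g l x = A * max 0 (x $ l) powr g"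

text \<open>With y = \<open>x $ l\<close>, the dilation r = k \<tau>, k = |\<open>\<xi> $ l\<close>|
  / y, turns the integrand into \<open>profile_kernel\<close>. It yields k^(1+2s), of which the
  change of measure takes back one factor k.\<close>

lemma I_dir_half_power:
  fixes x \<xi> :: "real ^ 'n::finite"
  assumes "x $ l > 0"
  shows "I_dir c s \<xi> (half_power A g l) x =
    \<bar>\<xi> $ l\<bar> powr (2 * s) *
      (c * A * (x $ l) powr (g - 2 * s) * (LINT r:{0<..}|lborel. profile_kernel s g r))"
proof (cases "\<xi> $ l = 0")
  \<comment> \<open>The function is constant along the line, and on the right
    \<open>0 powr (2 * s) = 0\<close>.\<close>
  case True
  then show ?thesis by (simp add: I_dir_def half_power_def set_lebesgue_integral_def)
next
  case False
  define y where "y = x $ l"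
  define k where "k = \<bar>\<xi> $ l\<bar> / y"
  have y: "0 < y" and k: "0 < k" using assms False by (auto simp: y_def k_def)
  define h where "h \<tau> = indicator {0<..} \<tau> * profile_kernel s g \<tau>" for \<tau>
  have integrand: "(half_power A g l (x + \<tau> *\<^sub>R \<xi>) + half_power A g l (x - \<tau> *\<^sub>R \<xi>) - 2 * half_power A g l x)
      / \<tau> powr (1 + 2 * s) = A * y powr g * k powr (1 + 2 * s) * profile_kernel s g (k * \<tau>)"
    if "0 < \<tau>" for \<tau>
  proof -
    have "y * (1 + k * \<tau>) = y + \<tau> * \<bar>\<xi> $ l\<bar>" "y * max 0 (1 - k * \<tau>) = max 0 (y - \<tau> * \<bar>\<xi> $ l\<bar>)"
      using y by (auto simp: k_def field_simps max_def)
    moreover have "0 < 1 + k * \<tau>" using k that by (simp add: add_pos_pos)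
    ultimately have
      "y powr g * (1 + k * \<tau>) powr g = (y + \<tau> * \<bar>\<xi> $ l\<bar>) powr g"
      "y powr g * max 0 (1 - k * \<tau>) powr g = max 0 (y - \<tau> * \<bar>\<xi> $ l\<bar>) powr g"
      using y by (simp_all flip: powr_mult)
    \<comment> \<open>Changing the sign of \<open>\<xi> $ l\<close> only swaps the two
      summands.\<close>
    moreover have "max 0 (y + \<tau> * \<xi> $ l) powr g + max 0 (y - \<tau> * \<xi> $ l) powr g
        = (y + \<tau> * \<bar>\<xi> $ l\<bar>) powr g + max 0 (y - \<tau> * \<bar>\<xi> $ l\<bar>) powr g"
      using y that by (cases "0 \<le> \<xi> $ l") (auto simp: max_def not_le mult_nonneg_nonneg dest: mult_pos_neg[of \<tau>])
    ultimately have "max 0 (y + \<tau> * \<xi> $ l) powr g + max 0 (y - \<tau> * \<xi> $ l) powr g - 2 * y powr g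
        = y powr g * ((1 + k * \<tau>) powr g + max 0 (1 - k * \<tau>) powr g - 2)"
      by (simp add: algebra_simps)
    moreover have "(k * \<tau>) powr (1 + 2 * s) = k powr (1 + 2 * s) * \<tau> powr (1 + 2 * s)"
      using k that by (simp add: powr_mult)
    moreover have "k powr (1 + 2 * s) > 0" using k by simp
    ultimately show ?thesis
      using y by (simp add: half_power_def profile_kernel_def y_def[symmetric] distrib_left[symmetric]
          right_diff_distrib[symmetric] mult.left_commute[of 2] del: distrib_left_numeral)
  qed
  have "(LINT \<tau>:{0<..}|lebesgue.
      (half_power A g l (x + \<tau> *\<^sub>R \<xi>) + half_power A g l (x - \<tau> *\<^sub>R \<xi>) - 2 * half_power A g l x)
        / \<tau> powr (1 + 2 * s))
      = (LINT \<tau>|lebesgue. A * y powr g * k powr (1 + 2 * s) * h (k * \<tau>))"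
    unfolding set_lebesgue_integral_def using k integrand
    by (intro Bochner_Integration.integral_cong) (auto simp: h_def indicator_def zero_less_mult_iff)
  also have "\<dots> = (LINT \<tau>|lborel. A * y powr g * k powr (1 + 2 * s) * h (k * \<tau>))"
    by (intro integral_completion) (simp add: h_def)
  also have "\<dots> = A * y powr g * k powr (1 + 2 * s) * (LINT \<tau>|lborel. h (k * \<tau>))"
    by simp
  also have "(LINT \<tau>|lborel. h (k * \<tau>)) = (LINT \<tau>|lborel. h \<tau>) / k"
    using lborel_integral_real_affine[of k h 0] k by simp
  also have "(LINT \<tau>|lborel. h \<tau>) = (LINT r:{0<..}|lborel. profile_kernel s g r)"
    by (simp add: h_def set_lebesgue_integral_def)
  also have "A * y powr g * k powr (1 + 2 * s) * ((LINT r:{0<..}|lborel. profile_kernel s g r) / k)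
      = A * (y powr g * k powr (2 * s)) * (LINT r:{0<..}|lborel. profile_kernel s g r)"
    using k by (simp add: powr_add)
  also have "y powr g * k powr (2 * s) = \<bar>\<xi> $ l\<bar> powr (2 * s) * y powr (g - 2 * s)"
    using y by (simp add: k_def powr_divide powr_diff)
  finally show ?thesis by (simp add: I_dir_def y_def mult_ac)
qed

section \<open>Regularity and growth of the power function\<close>

text \<open>By homogeneity the sum can be normalized to 1, where t \<le> t^g for t in
  [0, 1].\<close>

lemma powr_subadditive:
  fixes a b g :: real
  assumes "0 \<le> a" "0 \<le> b" "0 < g" "g \<le> 1"
  shows "(a + b) powr g \<le> a powr g + b powr g"
proof (cases "a + b = 0")
  case False
  define t where "t = a / (a + b)"
  have t: "0 \<le> t" "t \<le> 1" "a = (a + b) * t" "b = (a + b) * (1 - t)"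
    using assms False by (auto simp: t_def field_simps)
  have "t \<le> t powr g" "1 - t \<le> (1 - t) powr g"
    using powr_mono'[of g 1 t] powr_mono'[of g 1 "1 - t"] t assms by auto
  then have "(a + b) powr g * 1 \<le> (a + b) powr g * (t powr g + (1 - t) powr g)"
    by (intro mult_left_mono) auto
  also have "\<dots> = ((a + b) * t) powr g + ((a + b) * (1 - t)) powr g"
    using t(1,2) assms by (simp add: powr_mult distrib_left)
  finally show ?thesis unfolding t(3,4)[symmetric] by simp
qed (use assms in auto)

lemma half_power_holder:
  assumes "0 \<le> A" "0 < g" "g \<le> 1"
  shows "half_power A g l \<in> holder_space g"
proof -
  have one_sided: "max 0 a powr g \<le> max 0 b powr g + \<bar>a - b\<bar> powr g" for a b :: real
  proof -
    have "max 0 a powr g \<le> (max 0 b + \<bar>a - b\<bar>) powr g"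
      using assms by (intro powr_mono2) auto
    also have "\<dots> \<le> max 0 b powr g + \<bar>a - b\<bar> powr g"
      using assms by (intro powr_subadditive) auto
    finally show ?thesis .
  qed
  have "\<bar>half_power A g l x - half_power A g l y\<bar> \<le> A * norm (x - y) powr g" for x y
  proof -
    have "\<bar>max 0 (x $ l) powr g - max 0 (y $ l) powr g\<bar> \<le> \<bar>x $ l - y $ l\<bar> powr g"
      using one_sided[of "x $ l" "y $ l"] one_sided[of "y $ l" "x $ l"]
      by (simp add: abs_le_iff abs_minus_commute)
    also have "\<dots> \<le> norm (x - y) powr g"
      using component_le_norm_cart[of "x - y" l] assms by (intro powr_mono2) auto
    finally show ?thesis
      using assms by (simp add: half_power_def abs_mult mult_left_mono flip: right_diff_distrib)
  qed
  then show ?thesis using assms unfolding holder_space_def by blast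
qed

lemma half_power_growth_space:
  assumes "0 < A" "0 < g" "g < 2 * s"
  shows "half_power A g l \<in> growth_space s l"
proof -
  have "(\<lambda>\<tau>. half_power A g l (x + \<tau> *\<^sub>R \<xi>)) \<in> borel_measurable lebesgue" for x \<xi>
    unfolding half_power_def vector_add_component vector_scaleR_component
    by (intro measurable_completion) simp
  moreover have "\<bar>half_power A g l x\<bar> \<le> A * (1 + norm x) powr g" for x
    using assms component_le_norm_cart[of x l] norm_ge_zero[of x]
    by (auto simp: half_power_def abs_mult intro!: mult_left_mono powr_mono2)
  ultimately show ?thesis
    unfolding growth_space_def using assms
    by (intro CollectI conjI exI[of _ g] exI[of _ A]) auto
qed

text \<open>Derivative formulas are available only inside the half-space, so each level of the
  recursion must allow replacing a function by one that agrees with it on the open set.\<close>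

lemma Ck_on_cong:
  assumes "open S" "\<And>x. x \<in> S \<Longrightarrow> f x = g x" "Ck_on k S f"
  shows "Ck_on k S g"
  using assms(2,3)
proof (induction k arbitrary: f g)
  case 0
  then show ?case by (auto cong: continuous_on_cong)
next
  case (Suc k)
  have diff: "f differentiable at x" if "x \<in> S" for x using Suc.prems that by simp
  have "g differentiable at x" if "x \<in> S" for x
    using diff[OF that] Suc.prems(1) that \<open>open S\<close>
    by (metis differentiable_def has_derivative_transform_within_open)
  moreover have "Ck_on k S (\<lambda>x. frechet_derivative g (at x) v)" for v
  proof (rule Suc.IH)
    show "Ck_on k S (\<lambda>x. frechet_derivative f (at x) v)" using Suc.prems by simp
    show "frechet_derivative f (at x) v = frechet_derivative g (at x) v" if "x \<in> S" for x
      using frechet_derivative_transform_within_open[OF diff[OF that] \<open>open S\<close> that Suc.prems(1)]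
      by simp
  qed
  ultimately show ?case by simp
qed

lemma open_half_space: "open (half_space l)"
  unfolding half_space_def by (intro open_Collect_less continuous_intros)

text \<open>Directional derivatives stay within this family, with the exponent lowered by 1; hence
  the induction keeps \<open>a\<close> and \<open>b\<close> arbitrary.\<close>

lemma Ck_on_power:
  "Ck_on k (half_space l) (\<lambda>x :: real ^ 'n::finite. a * (x $ l) powr b)"
proof (induction k arbitrary: a b)
  case 0
  show ?case by (auto intro!: continuous_intros simp: half_space_def)
next
  case (Suc k)
  have deriv: "((\<lambda>x :: real ^ 'n. a * (x $ l) powr b) has_derivative
      (\<lambda>v. a * (b * (x $ l) powr (b - 1) * v $ l))) (at x)"
    if "x \<in> half_space l" for x
  proof -
    have "((\<lambda>t. a * t powr b) has_real_derivative a * (b * (x $ l) powr (b - 1))) (at (x $ l))"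
      using that by (auto intro!: derivative_eq_intros simp: half_space_def)
    from has_derivative_compose[OF bounded_linear_imp_has_derivative[OF bounded_linear_vec_nth]
        this[unfolded has_field_derivative_def]]
    show ?thesis by (simp add: mult.assoc)
  qed
  have "Ck_on k (half_space l) (\<lambda>x :: real ^ 'n. frechet_derivative (\<lambda>x. a * (x $ l) powr b) (at x) v)" for v
    by (rule Ck_on_cong[OF open_half_space _ Suc.IH[of "a * b * v $ l" "b - 1"]])
      (simp add: frechet_derivative_at[OF deriv, symmetric])
  then show ?case
    using deriv by (auto simp: differentiable_def)
qed

lemma half_power_smooth: "Cinf_on (half_space l) (half_power A g l)"
  unfolding Cinf_on_def
  by (intro allI Ck_on_cong[OF open_half_space _ Ck_on_power]) (auto simp: half_power_def half_space_def)

section \<open>Orthonormal families and the extremal operators\<close>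

text \<open>Expanding the axis vector in the basis gives total squared weight 1. Each component is
  at most 1 in modulus, so lowering the exponent from 2 to 2s does not decrease it.\<close>

lemma sum_orthonormal_basis_powr_ge_1:
  fixes B :: "(real ^ 'n::finite) set"
  assumes "B \<in> orthonormal_families CARD('n)" "0 < s" "s \<le> 1"
  shows "1 \<le> (\<Sum>\<xi>\<in>B. \<bar>\<xi> $ l\<bar> powr (2 * s))"
proof -
  have B: "finite B" "card B = CARD('n)" "pairwise orthogonal B" "\<And>\<xi>. \<xi> \<in> B \<Longrightarrow> norm \<xi> = 1"
    using assms by (auto simp: orthonormal_families_def)
  have "independent B" using B by (intro pairwise_orthogonal_independent) force+
  then have "UNIV \<subseteq> span B" using B by (intro card_ge_dim_independent) auto
  define e :: "real ^ 'n" where "e = axis l 1"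
  have "1 = e \<bullet> e" by (simp add: e_def inner_axis_axis)
  also have "\<dots> = (\<Sum>\<xi>\<in>B. (e \<bullet> \<xi>) *\<^sub>R \<xi>) \<bullet> e"
    using orthonormal_basis_expand[of B e] B \<open>UNIV \<subseteq> span B\<close> by (simp add: subset_iff)
  also have "\<dots> = (\<Sum>\<xi>\<in>B. (\<xi> $ l)\<^sup>2)"
    by (simp add: inner_sum_left e_def cart_eq_inner_axis[symmetric] inner_commute[of "axis l 1"] power2_eq_square)
  also have "\<dots> \<le> (\<Sum>\<xi>\<in>B. \<bar>\<xi> $ l\<bar> powr (2 * s))"
  proof (rule sum_mono)
    fix \<xi> assume "\<xi> \<in> B"
    then have "\<bar>\<xi> $ l\<bar> \<le> 1" using component_le_norm_cart[of \<xi> l] B by auto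
    then have "\<bar>\<xi> $ l\<bar> powr 2 \<le> \<bar>\<xi> $ l\<bar> powr (2 * s)"
      using assms by (intro powr_mono') auto
    then show "(\<xi> $ l)\<^sup>2 \<le> \<bar>\<xi> $ l\<bar> powr (2 * s)" by (simp add: powr_numeral)
  qed
  finally show ?thesis .
qed

text \<open>Supplies the competitor for the infimum, and nonemptiness for the supremum.\<close>

lemma orthonormal_family_containing_axis:
  assumes "1 \<le> k" "k \<le> CARD('n::finite)"
  obtains B :: "(real ^ 'n) set" where "B \<in> orthonormal_families k" "axis l 1 \<in> B"
proof -
  let ?e = "axis l 1 :: real ^ 'n"
  have "?e \<in> Basis" by (simp add: axis_in_Basis_iff)
  then have "k - 1 \<le> card (Basis - {?e})" using assms by simp
  then obtain T where T: "T \<subseteq> Basis - {?e}" "card T = k - 1" "finite T"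
    by (rule obtain_subset_with_card_n)
  then have "insert ?e T \<subseteq> Basis" "card (insert ?e T) = k"
    using \<open>?e \<in> Basis\<close> assms by (auto simp: card_insert_if)
  then have "insert ?e T \<in> orthonormal_families k"
    using T pairwise_subset[OF orthogonal_Basis] by (auto simp: orthonormal_families_def simp del: insert_subset)
  then show ?thesis using that by blast
qed

text \<open>For the infimum, one family containing the axis suffices: the axis contributes
  \<open>M\<close> and the other directions at most 0. For the supremum every family must have total
  weight at least 1, which full bases guarantee; with fewer vectors all of them could be orthogonal
  to the axis.\<close>

lemma extremal_operator_le:
  fixes u :: "real ^ 'n::finite \<Rightarrow> real"
  assumes dir: "\<And>\<xi>. I_dir c s \<xi> u x = \<bar>\<xi> $ l\<bar> powr (2 * s) * M"
    and "M \<le> 0" "0 < s" "s \<le> 1"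
    and "(\<exists>k. 1 \<le> k \<and> k \<le> CARD('n) \<and> I = I_minus c s k) \<or> I = I_plus c s CARD('n)"
  shows "I u x \<le> M"
  using assms(5)
proof
  assume "\<exists>k. 1 \<le> k \<and> k \<le> CARD('n) \<and> I = I_minus c s k"
  then obtain k where k: "1 \<le> k" "k \<le> CARD('n)" "I = I_minus c s k" by blast
  obtain B :: "(real ^ 'n) set" where B: "B \<in> orthonormal_families k" "axis l 1 \<in> B"
    using orthonormal_family_containing_axis k by metis
  \<comment> \<open>A real \<open>INF\<close> lies below its members only if the set is bounded
    below. As all weights are at most 1, k M is a lower bound.\<close>
  have "bdd_below ((\<lambda>B. \<Sum>\<xi>\<in>B. I_dir c s \<xi> u x) ` orthonormal_families k)"
  proof (rule bdd_belowI2)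
    fix B :: "(real ^ 'n) set" assume B: "B \<in> orthonormal_families k"
    have "M \<le> I_dir c s \<xi> u x" if "\<xi> \<in> B" for \<xi>
    proof -
      have "\<bar>\<xi> $ l\<bar> \<le> 1"
        using B that component_le_norm_cart[of \<xi> l] by (auto simp: orthonormal_families_def)
      then have "\<bar>\<xi> $ l\<bar> powr (2 * s) \<le> 1" using \<open>0 < s\<close> by (intro powr_le1) auto
      then show ?thesis
        using mult_right_mono_neg[of "\<bar>\<xi> $ l\<bar> powr (2 * s)" 1 M] \<open>M \<le> 0\<close> by (simp add: dir)
    qed
    then have "(\<Sum>\<xi>\<in>B. M) \<le> (\<Sum>\<xi>\<in>B. I_dir c s \<xi> u x)" by (rule sum_mono)
    then show "real k * M \<le> (\<Sum>\<xi>\<in>B. I_dir c s \<xi> u x)"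
      using B by (simp add: orthonormal_families_def)
  qed
  then have "I u x \<le> (\<Sum>\<xi>\<in>B. I_dir c s \<xi> u x)"
    unfolding k(3) I_minus_def using B(1) by (rule cINF_lower)
  also have "\<dots> = I_dir c s (axis l 1) u x + (\<Sum>\<xi>\<in>B - {axis l 1}. I_dir c s \<xi> u x)"
    using B by (intro sum.remove) (auto simp: orthonormal_families_def)
  also have "\<dots> \<le> I_dir c s (axis l 1) u x + 0"
    using \<open>M \<le> 0\<close> by (intro add_left_mono sum_nonpos) (simp add: dir mult_nonneg_nonpos)
  finally show ?thesis by (simp add: dir)
next
  assume I: "I = I_plus c s CARD('n)"
  have "orthonormal_families CARD('n) \<noteq> ({} :: (real ^ 'n) set set)"
    using orthonormal_family_containing_axis[of "CARD('n)"] by (metis One_nat_def Suc_leI empty_iff le_refl zero_less_card_finite)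
  then show ?thesis
    unfolding I I_plus_def
  proof (rule cSUP_least)
    fix B :: "(real ^ 'n) set" assume "B \<in> orthonormal_families CARD('n)"
    then have "1 \<le> (\<Sum>\<xi>\<in>B. \<bar>\<xi> $ l\<bar> powr (2 * s))"
      using sum_orthonormal_basis_powr_ge_1 assms by blast
    then show "(\<Sum>\<xi>\<in>B. I_dir c s \<xi> u x) \<le> M"
      using mult_right_mono_neg[of 1 _ M] \<open>M \<le> 0\<close> by (simp add: dir flip: sum_distrib_right)
  qed
qed

theorem theorem1p7:
  fixes C\<^sub>s s p :: real
    and l :: "'n::finite"
    and I :: "(real ^ 'n \<Rightarrow> real) \<Rightarrow> real ^ 'n \<Rightarrow> real"
  assumes "CARD('n) \<ge> 2" and "0 < s" and "s < 1" and "C\<^sub>s > 0"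
    and "(\<exists>k. 1 \<le> k \<and> k \<le> CARD('n) \<and> I = I_minus C\<^sub>s s k) \<or> I = I_plus C\<^sub>s s CARD('n)"
    and "p < -1"
  shows "\<exists>u :: real ^ 'n \<Rightarrow> real.
           supersolution s l I p u \<and>
           u \<in> holder_space (2 * s / (1 - p)) \<and>
           Cinf_on (half_space l) u \<and>
           (\<forall>x\<in>half_space l. u x > 0) \<and>
           (\<forall>x. x \<notin> half_space l \<longrightarrow> u x = 0)"
proof -
  \<comment> \<open>This exponent matches the homogeneities, g - 2s = g p, and g < s amounts to p <
    -1.\<close>
  define g where "g = 2 * s / (1 - p)"
  have g: "0 < g" "g < s" and scaling: "g * p = g - 2 * s"
    using mult_pos_neg[of s "1 + p"] assms by (simp_all add: g_def field_simps)
  define \<Phi> where "\<Phi> = (LINT r:{0<..}|lborel. profile_kernel s g r)"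
  have "\<Phi> < 0" using profile_kernel_integral_neg g assms by (simp add: \<Phi>_def)
  \<comment> \<open>Solves \<open>C\<^sub>s * A * \<Phi> + A powr p = 0\<close>, the coefficient of
    the common power of \<open>x $ l\<close>; since p - 1 < 0, any larger amplitude makes this
    coefficient negative.\<close>
  define A where "A = (- C\<^sub>s * \<Phi>) powr (1 / (p - 1))"
  have "0 < - C\<^sub>s * \<Phi>" using \<open>\<Phi> < 0\<close> assms by (simp add: mult_pos_neg)
  then have A: "0 < A" "A powr (p - 1) = - C\<^sub>s * \<Phi>"
    using \<open>\<Phi> < 0\<close> assms by (simp_all add: A_def powr_powr)
  define u where "u = half_power A g l"
  have pos: "u x > 0" if "x \<in> half_space l" for x
    using that A by (simp add: u_def half_power_def half_space_def)
  have "I u x + u x powr p \<le> 0" if "x \<in> half_space l" for x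
  proof -
    have x: "x $ l > 0" using that by (simp add: half_space_def)
    have "I u x \<le> C\<^sub>s * A * (x $ l) powr (g - 2 * s) * \<Phi>"
    proof (rule extremal_operator_le[OF _ _ _ _ assms(5)])
      show "I_dir C\<^sub>s s \<xi> u x = \<bar>\<xi> $ l\<bar> powr (2 * s) * (C\<^sub>s * A * (x $ l) powr (g - 2 * s) * \<Phi>)" for \<xi>
        unfolding u_def \<Phi>_def by (rule I_dir_half_power[OF x])
      show "C\<^sub>s * A * (x $ l) powr (g - 2 * s) * \<Phi> \<le> 0"
        using assms A \<open>\<Phi> < 0\<close> by (intro mult_nonneg_nonpos) auto
    qed (use assms in auto)
    moreover have "u x powr p = A powr p * (x $ l) powr (g - 2 * s)"
      using x A scaling by (simp add: u_def half_power_def powr_mult powr_powr)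
    moreover have "A powr p = A * (- C\<^sub>s * \<Phi>)"
      using A by (simp add: powr_diff field_simps flip: A(2))
    ultimately show ?thesis by (simp add: algebra_simps)
  qed
  moreover have "Cinf_on (half_space l) u" by (simp add: u_def half_power_smooth)
  moreover from this have "Ck_on 2 (half_space l) u" unfolding Cinf_on_def by blast
  moreover have "u \<in> growth_space s l"
    using half_power_growth_space[of A g s l] A g by (simp add: u_def)
  moreover have "u \<in> holder_space (2 * s / (1 - p))"
    using half_power_holder[of A g l] A(1) g \<open>s < 1\<close> by (simp add: u_def flip: g_def)
  moreover have "u x = 0" if "x \<notin> half_space l" for x
    using that by (simp add: u_def half_power_def half_space_def max_def)
  ultimately show ?thesis using pos unfolding supersolution_def by blast
qed

end
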